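(* Let $p>1$, let $I\subseteq\mathbb{R}$ be an interval, let $f:I\to[0,\infty)$ be a Young-convex function (with parameter $p$), and let $a,b\in I$ with $a<b$. Then $$\frac{1}{b-a}\int_a^b f(x)\,dx\le \frac{p^2+2p}{(p+1)(2p+1)}\,f(a)+\frac{3p^2}{(p+1)(2p+1)}\,f(b).$$
   Context: Definition (Young-convex function). Let $p>1$ and let $I\subseteq\mathbb{R}$ be a nonempty interval. A function $f:I\to[0,\infty)$ is called Young-convex (with parameter $p$) if $$f(tx+(1-t)y)\le\left(\frac1p t^{\frac1p}+\frac{p-1}{p}t^{1+\frac1p}\right)f(x)+\left(\frac{p-1}{p}(1-t)t^{\frac1p}+\frac1p t^{\frac1p-1}(1-t)\right)f(y)$$ for all $x,y\in I$ and all $t\in(0,1]$. *)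

theory Defs
  imports "HOL-Analysis.Analysis"
begin

text \<open>
  A function \<open>f : I \<rightarrow> [0,\<infinity>)\<close> is represented by a total function on the reals, of which
  only the values on \<open>I\<close> are constrained. The value \<open>t = 0\<close> is excluded because
  of the factor \<open>t powr (1/p - 1)\<close>, which is unbounded near \<open>0\<close> (whereas
  \<open>0 powr (1/p - 1) = 0\<close> by convention).
\<close>

definition young_convex_on :: "real \<Rightarrow> real set \<Rightarrow> (real \<Rightarrow> real) \<Rightarrow> bool" where
  "young_convex_on p I f \<longleftrightarrow>
     p > 1 \<and> I \<noteq> {} \<and> is_interval I \<and> (\<forall>x\<in>I. f x \<ge> 0) \<and>
     (\<forall>x\<in>I. \<forall>y\<in>I. \<forall>t\<in>{0<..1}.
        f (t * x + (1 - t) * y) \<le>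
          (1 / p * t powr (1 / p) + (p - 1) / p * t powr (1 + 1 / p)) * f x +
          ((p - 1) / p * (1 - t) * t powr (1 / p) + 1 / p * t powr (1 / p - 1) * (1 - t)) * f y)"

end

theory Submission
  imports Defs
begin

text \<open>
  Write the defining inequality as \<open>f (t x + (1 - t) y) \<le> A t * f x + B t * f y\<close>.
  Integrating it over \<open>t \<in> [0, 1]\<close> with \<open>x = a\<close>, \<open>y = b\<close> gives the bound.
  Integrability has to be derived from the inequality: since \<open>A t \<rightarrow> 1\<close> and
  \<open>B t \<rightarrow> 0\<close> as \<open>t \<rightarrow> 1\<close>, applying it once with \<open>x\<close> and
  once with a nearby \<open>z\<close> as the first point squeezes \<open>f z\<close> towards \<open>f x\<close>, so
  \<open>f\<close> is continuous inside \<open>I\<close>; and near the end points it is dominated by the integrable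
  majorant.
\<close>

definition young_left :: "real \<Rightarrow> real \<Rightarrow> real" where
  "young_left p t = 1 / p * t powr (1 / p) + (p - 1) / p * t powr (1 + 1 / p)"

definition young_right :: "real \<Rightarrow> real \<Rightarrow> real" where
  "young_right p t =
     (p - 1) / p * (1 - t) * t powr (1 / p) + 1 / p * t powr (1 / p - 1) * (1 - t)"

lemma young_convex_onD:
  assumes "young_convex_on p I f" "x \<in> I" "y \<in> I" "0 < t" "t \<le> 1"
  shows "f (t * x + (1 - t) * y) \<le> young_left p t * f x + young_right p t * f y"
  using assms unfolding young_convex_on_def young_left_def young_right_def by auto

lemma young_left_pos: "p > 1 \<Longrightarrow> t > 0 \<Longrightarrow> young_left p t > 0"
  unfolding young_left_def by (intro add_pos_pos mult_pos_pos) auto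

lemma tendsto_young_left_1:
  assumes "p > 1" "(t \<longlongrightarrow> 1) F"
  shows "((\<lambda>z. young_left p (t z)) \<longlongrightarrow> 1) F"
proof -
  have "((\<lambda>z. young_left p (t z)) \<longlongrightarrow>
      1 / p * 1 powr (1 / p) + (p - 1) / p * 1 powr (1 + 1 / p)) F"
    unfolding young_left_def using assms by (intro tendsto_intros) auto
  also have "1 / p * 1 powr (1 / p) + (p - 1) / p * 1 powr (1 + 1 / p) = 1"
    using assms by (simp add: field_simps)
  finally show ?thesis .
qed

lemma tendsto_young_right_1:
  assumes "(t \<longlongrightarrow> 1) F"
  shows "((\<lambda>z. young_right p (t z)) \<longlongrightarrow> 0) F"
proof -
  have "((\<lambda>z. young_right p (t z)) \<longlongrightarrow>
      (p - 1) / p * (1 - 1) * 1 powr (1 / p) + 1 / p * 1 powr (1 / p - 1) * (1 - 1)) F"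
    unfolding young_right_def using assms by (intro tendsto_intros) auto
  then show ?thesis by simp
qed

text \<open>The points \<open>c\<close> and \<open>d\<close> lie on opposite sides of
  \<open>x\<close>, and \<open>z\<close> tends to \<open>x\<close> from the side of
  \<open>d\<close>. The upper bound writes \<open>z\<close> as a combination of \<open>x\<close> and
  \<open>d\<close>, the lower bound writes \<open>x\<close> as a combination of \<open>z\<close> and
  \<open>c\<close>. Stating the order through quotients makes it invariant under reflection, so both
  one-sided limits are instances.\<close>

lemma young_convex_on_tendsto:
  fixes p c d x :: real
  assumes f: "young_convex_on p I f" and I: "c \<in> I" "d \<in> I" "x \<in> I"
    and ne: "c \<noteq> x" "d \<noteq> x" and F: "((\<lambda>z. z) \<longlongrightarrow> x) F"
    and in_I: "\<forall>\<^sub>F z in F. z \<in> I"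
    and right: "\<forall>\<^sub>F z in F. 0 < (d - z) / (d - x) \<and> (d - z) / (d - x) \<le> 1"
    and left: "\<forall>\<^sub>F z in F. 0 < (x - c) / (z - c) \<and> (x - c) / (z - c) \<le> 1"
  shows "(f \<longlongrightarrow> f x) F"
proof (rule tendsto_sandwich)
  have p: "p > 1" using f by (simp add: young_convex_on_def)
  define s where "s z = (d - z) / (d - x)" for z
  define r where "r z = (x - c) / (z - c)" for z
  have "(s \<longlongrightarrow> (d - x) / (d - x)) F"
    unfolding s_def using ne by (intro tendsto_intros F) auto
  then have s: "(s \<longlongrightarrow> 1) F" using ne by simp
  have "(r \<longlongrightarrow> (x - c) / (x - c)) F"
    unfolding r_def using ne by (intro tendsto_intros F) auto
  then have r: "(r \<longlongrightarrow> 1) F" using ne by simp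
  show "\<forall>\<^sub>F z in F. f z \<le> young_left p (s z) * f x + young_right p (s z) * f d"
    using right
  proof eventually_elim
    case (elim z)
    have "s z * x + (1 - s z) * d = d - s z * (d - x)" by (simp add: algebra_simps)
    also have "\<dots> = z" using ne by (simp add: s_def)
    finally show ?case
      using young_convex_onD[OF f I(3,2), of "s z"] elim by (simp add: s_def)
  qed
  \<comment> \<open>The inequality with \<open>z\<close> as first point is solved for
    \<open>f z\<close>, dividing by the positive coefficient
    \<open>young_left p (r z)\<close>.\<close>
  show "\<forall>\<^sub>F z in F. (f x - young_right p (r z) * f c) / young_left p (r z) \<le> f z"
    using left in_I
  proof eventually_elim
    case (elim z)
    \<comment> \<open>For \<open>z = c\<close> the quotient would be \<open>0\<close>, the value of
      division by zero, against its strict positivity.\<close>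
    then have "z \<noteq> c" by auto
    have "r z * z + (1 - r z) * c = c + r z * (z - c)" by (simp add: algebra_simps)
    also have "\<dots> = x" using \<open>z \<noteq> c\<close> by (simp add: r_def)
    finally have "f x \<le> young_left p (r z) * f z + young_right p (r z) * f c"
      using young_convex_onD[OF f _ I(1), of z "r z"] elim by (simp add: r_def)
    moreover have "young_left p (r z) > 0"
      using elim by (intro young_left_pos p) (simp add: r_def)
    ultimately show ?case by (simp add: field_simps)
  qed
  have "((\<lambda>z. young_left p (s z) * f x + young_right p (s z) * f d) \<longlongrightarrow> 1 * f x + 0 * f d) F"
    by (intro tendsto_intros tendsto_young_left_1 tendsto_young_right_1 p s)
  then show "((\<lambda>z. young_left p (s z) * f x + young_right p (s z) * f d) \<longlongrightarrow> f x) F"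
    by simp
  have "((\<lambda>z. (f x - young_right p (r z) * f c) / young_left p (r z)) \<longlongrightarrow> (f x - 0 * f c) / 1) F"
    by (intro tendsto_intros tendsto_young_left_1 tendsto_young_right_1 p r) simp
  then show "((\<lambda>z. (f x - young_right p (r z) * f c) / young_left p (r z)) \<longlongrightarrow> f x) F"
    by simp
qed

lemma young_convex_on_continuous_on:
  assumes f: "young_convex_on p I f" and I: "a \<in> I" "b \<in> I"
  shows "continuous_on {a<..<b} f"
proof (rule continuous_at_imp_continuous_on, rule ballI)
  fix x assume x: "x \<in> {a<..<b}"
  have sub: "{a..b} \<subseteq> I"
    using f I mem_is_interval_1_I[of I a b] by (auto simp: young_convex_on_def)
  then have "x \<in> I" using x by auto
  have "(f \<longlongrightarrow> f x) (at_right x)"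
  proof (rule young_convex_on_tendsto[OF f I \<open>x \<in> I\<close>])
    have ev: "\<forall>\<^sub>F z in at_right x. z \<in> {x<..<b}"
      using x by (intro eventually_at_right_real) auto
    show "\<forall>\<^sub>F z in at_right x. z \<in> I"
      using ev by eventually_elim (use x sub in auto)
    show "\<forall>\<^sub>F z in at_right x. 0 < (b - z) / (b - x) \<and> (b - z) / (b - x) \<le> 1"
      using ev by eventually_elim (use x in auto)
    show "\<forall>\<^sub>F z in at_right x. 0 < (x - a) / (z - a) \<and> (x - a) / (z - a) \<le> 1"
      using ev by eventually_elim (use x in auto)
  qed (use x in auto)
  moreover have "(f \<longlongrightarrow> f x) (at_left x)"
  \<comment> \<open>Here \<open>a\<close> and \<open>b\<close> exchange roles: \<open>z\<close> lies
    between \<open>a\<close> and \<open>x\<close>, and \<open>x\<close> between \<open>z\<close> and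
    \<open>b\<close>.\<close>
  proof (rule young_convex_on_tendsto[OF f I(2,1) \<open>x \<in> I\<close>])
    have ev: "\<forall>\<^sub>F z in at_left x. z \<in> {a<..<x}"
      using x by (intro eventually_at_left_real) auto
    show "\<forall>\<^sub>F z in at_left x. z \<in> I"
      using ev by eventually_elim (use x sub in auto)
    show "\<forall>\<^sub>F z in at_left x. 0 < (a - z) / (a - x) \<and> (a - z) / (a - x) \<le> 1"
      using ev by eventually_elim (use x in \<open>auto simp: field_simps\<close>)
    show "\<forall>\<^sub>F z in at_left x. 0 < (x - b) / (z - b) \<and> (x - b) / (z - b) \<le> 1"
      using ev by eventually_elim (use x in \<open>auto simp: field_simps\<close>)
  qed (use x in auto)
  ultimately show "isCont f x"
    by (simp add: isCont_def filterlim_split_at)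
qed

text \<open>The range of \<open>e\<close> includes the negative exponent \<open>1 / p - 1\<close>,
  whose power is unbounded near \<open>0\<close>.\<close>

lemma has_integral_powr_unit:
  fixes e :: real
  assumes "e > -1"
  shows "((\<lambda>t. t powr e) has_integral 1 / (e + 1)) {0..1}"
  using has_integral_powr_from_0[OF assms, of 1] by simp

lemma young_left_has_integral:
  assumes "p > 1"
  shows "(young_left p has_integral (p^2 + 2 * p) / ((p + 1) * (2 * p + 1))) {0..1}"
proof -
  have inv: "1 / p > 0" using assms by simp
  have "(young_left p has_integral
      1 / p * (1 / (1 / p + 1)) + (p - 1) / p * (1 / (1 + 1 / p + 1))) {0..1}"
    unfolding young_left_def using assms
    by (intro has_integral_add has_integral_mult_right has_integral_powr_unit)
       (use inv in linarith)+
  also have "1 / p * (1 / (1 / p + 1)) + (p - 1) / p * (1 / (1 + 1 / p + 1)) =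
      1 / (p + 1) + (p - 1) / (2 * p + 1)"
  proof -
    have "1 / p + 1 = (p + 1) / p" "1 + 1 / p + 1 = (2 * p + 1) / p"
      using assms by (simp_all add: field_simps)
    then show ?thesis using assms by simp
  qed
  also have "\<dots> = (p^2 + 2 * p) / ((p + 1) * (2 * p + 1))"
    using assms by (subst add_frac_eq) (simp_all add: algebra_simps power2_eq_square)
  finally show ?thesis .
qed

text \<open>Expanding the factors \<open>1 - t\<close> produces exactly the two terms of
  \<open>young_left\<close> with a minus sign. Hence the two coefficients add up to a combination of
  two pure powers with integral \<open>2 * p / (p + 1)\<close>, and the known integral of
  \<open>young_left\<close> is subtracted.\<close>

lemma young_right_has_integral:
  assumes "p > 1"
  shows "(young_right p has_integral 3 * p^2 / ((p + 1) * (2 * p + 1))) {0..1}"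
proof -
  have eq: "young_right p t =
      (p - 1) / p * t powr (1 / p) + 1 / p * t powr (1 / p - 1) - young_left p t"
    if "t \<ge> 0" for t
  proof -
    \<comment> \<open>Both identities also hold at \<open>t = 0\<close>, since
      \<open>0 powr y = 0\<close> for every \<open>y\<close>.\<close>
    have "t * t powr (1 / p) = t powr (1 + 1 / p)" "t * t powr (1 / p - 1) = t powr (1 / p)"
      using that by (simp_all add: powr_mult_base)
    then show ?thesis
      unfolding young_right_def young_left_def
      by (simp add: algebra_simps flip: add_divide_distrib diff_divide_distrib)
  qed
  have inv: "1 / p > 0" using assms by simp
  have "((\<lambda>t. (p - 1) / p * t powr (1 / p) + 1 / p * t powr (1 / p - 1) - young_left p t)
      has_integral (p - 1) / p * (1 / (1 / p + 1)) + 1 / p * (1 / (1 / p - 1 + 1))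
        - (p^2 + 2 * p) / ((p + 1) * (2 * p + 1))) {0..1}"
    using assms
    by (intro has_integral_add has_integral_diff has_integral_mult_right has_integral_powr_unit
          young_left_has_integral) (use assms inv in linarith)+
  also have "(p - 1) / p * (1 / (1 / p + 1)) + 1 / p * (1 / (1 / p - 1 + 1)) = 2 * p / (p + 1)"
  proof -
    have "1 / p + 1 = (p + 1) / p"
      using assms by (simp add: field_simps)
    then have "(p - 1) / p * (1 / (1 / p + 1)) + 1 / p * (1 / (1 / p - 1 + 1)) =
        (p - 1) / (p + 1) + 1"
      using assms by simp
    also have "\<dots> = 2 * p / (p + 1)"
      using assms by (simp add: field_simps)
    finally show ?thesis .
  qed
  also have "2 * p / (p + 1) - (p^2 + 2 * p) / ((p + 1) * (2 * p + 1)) =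
      (2 * p * (2 * p + 1) - (p^2 + 2 * p)) / ((p + 1) * (2 * p + 1))"
    using assms by (simp add: diff_divide_distrib)
  also have "2 * p * (2 * p + 1) - (p^2 + 2 * p) = 3 * p^2"
    by (simp add: algebra_simps power2_eq_square)
  finally show ?thesis
    by (rule has_integral_eq[rotated]) (simp add: eq)
qed

theorem theorem3:
  fixes p a b :: real and I :: "real set" and f :: "real \<Rightarrow> real"
  assumes "p > 1"
    and "is_interval I"
    and "young_convex_on p I f"
    and "a \<in> I" and "b \<in> I" and "a < b"
  shows "f integrable_on {a..b} \<and>
    1 / (b - a) * integral {a..b} f \<le>
      (p^2 + 2 * p) / ((p + 1) * (2 * p + 1)) * f a +
      3 * p^2 / ((p + 1) * (2 * p + 1)) * f b"
proof -
  define J where "J = (p^2 + 2 * p) / ((p + 1) * (2 * p + 1)) * f a +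
      3 * p^2 / ((p + 1) * (2 * p + 1)) * f b"
  define H where "H t = young_left p t * f a + young_right p t * f b" for t
  \<comment> \<open>The parameter \<open>t = (b - x) / (b - a)\<close> is the one with
    \<open>x = t * a + (1 - t) * b\<close>, so \<open>h\<close> is the majorant as a function of the
    point \<open>x\<close>.\<close>
  define h where "h x = H ((b - x) / (b - a))" for x
  have H: "(H has_integral J) (cbox 0 1)"
    unfolding H_def J_def cbox_interval using assms(1)
    by (intro has_integral_add has_integral_mult_left young_left_has_integral
          young_right_has_integral)
  \<comment> \<open>This is the slope of \<open>t\<close> as a function of \<open>x\<close>. The
    change of variables divides the integral by its absolute value, which yields the factor
    \<open>b - a\<close>.\<close>
  define m where "m = - 1 / (b - a)"
  have m: "m \<noteq> 0" "1 / m = a - b" "\<bar>m\<bar> = 1 / (b - a)"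
    using \<open>a < b\<close> by (simp_all add: m_def)
  have "(\<lambda>x. (1 / m) *\<^sub>R x + - ((1 / m) *\<^sub>R (b / (b - a)))) = (\<lambda>x. (a - b) * x + b)"
    unfolding m using \<open>a < b\<close> by (auto simp: fun_eq_iff field_simps)
  moreover have "(\<lambda>x. (a - b) * x + b) ` cbox 0 1 = {a..b}"
    using \<open>a < b\<close> by (simp add: image_affinity_atLeastAtMost)
  moreover have "(\<lambda>x. H (m *\<^sub>R x + b / (b - a))) = h"
    by (simp add: fun_eq_iff h_def m_def diff_divide_distrib)
  ultimately have h: "(h has_integral (b - a) * J) {a..b}"
    using has_integral_affinity[OF H m(1), of "b / (b - a)"] by (simp only:) (simp add: m)
  then have h': "(h has_integral (b - a) * J) {a<..<b}"
    by (simp add: has_integral_Icc_iff_Ioo)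
  have le: "f x \<le> h x" if "x \<in> {a<..<b}" for x
  proof -
    define t where "t = (b - x) / (b - a)"
    have "t * a + (1 - t) * b = b - t * (b - a)" by (simp add: algebra_simps)
    also have "\<dots> = x" using \<open>a < b\<close> by (simp add: t_def)
    finally show ?thesis
      using young_convex_onD[OF assms(3-5), of t] that by (simp add: t_def h_def H_def)
  qed
  have nonneg: "f x \<ge> 0" if "x \<in> {a<..<b}" for x
  proof -
    have "x \<in> I"
      using that mem_is_interval_1_I[OF assms(2,4,5)] by auto
    then show ?thesis using assms(3) by (simp add: young_convex_on_def)
  qed
  \<comment> \<open>Continuity on the open interval gives measurability, and nonnegativity turns
    \<open>f x \<le> h x\<close> into a bound on the norm by an integrable function.\<close>
  have int: "f integrable_on {a<..<b}"
  proof (rule measurable_bounded_by_integrable_imp_integrable)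
    show "f \<in> borel_measurable (lebesgue_on {a<..<b})"
      by (intro continuous_imp_measurable_on_sets_lebesgue
            young_convex_on_continuous_on[OF assms(3-5)]) auto
    show "h integrable_on {a<..<b}" using h' by (rule has_integral_integrable)
    show "norm (f x) \<le> h x" if "x \<in> {a<..<b}" for x
      using le nonneg that by simp
  qed auto
  have "integral {a<..<b} f \<le> (b - a) * J"
    using integrable_integral[OF int] h' le by (rule has_integral_le)
  then have "1 / (b - a) * integral {a..b} f \<le> J"
    using \<open>a < b\<close> by (simp add: integral_open_interval_real field_simps)
  moreover have "f integrable_on {a..b}"
    using int by (simp add: integrable_on_Icc_iff_Ioo)
  ultimately show ?thesis by (simp add: J_def)
qed

end
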